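(* Let $I\subseteq L_{16}$ be a nonempty subset admitting a minimal covering $\mathcal{Q}_I=\{Q_1,\dots,Q_{N}\}$ by special quadruples contained in $I$, of cardinality $N=N_{\mathcal{Q}_I}$ and multiplicity $M_{\mathcal{Q}_I}$. Then the lattice state $\rho_I$ decomposes as the convex combination $$\rho_I=\frac{1}{N_{\mathcal{Q}_I}}\sum_{j=1}^{N_{\mathcal{Q}_I}}\rho_{Q_j},$$ and $\rho_I$ is separable.
   Context: $\sigma_0=\mathbb{1}_2$, $\sigma_1,\sigma_2,\sigma_3$ are the Pauli matrices, $\sigma_{\alpha\beta}=\sigma_\alpha\otimes\sigma_\beta\in M_4(\mathbb{C})$, and $L_{16}=\{(\alpha,\beta):\alpha,\beta\in\{0,1,2,3\}\}$. Let $|\Psi_+\rangle=\frac12\sum_{j=1}^4|j\rangle\otimes|j\rangle\in\mathbb{C}^4\otimes\mathbb{C}^4$ and let $P_{\alpha\beta}$ be the orthogonal projection onto $(\mathbb{1}_4\otimes\sigma_{\alpha\beta})|\Psi_+\rangle$. For nonempty $I\subseteq L_{16}$ with $N_I$ elements the lattice state is $\rho_I=\frac1{N_I}\sum_{(\alpha,\beta)\in I}P_{\alpha\beta}$, a density matrix on $\mathbb{C}^4\otimes\mathbb{C}^4$. A state is separable if it is a convex combination of product states $\rho^1\otimes\rho^2$. A special quadruple is a subset $Q\subset L_{16}$ of exactly 4 points for which there exist unit vectors $|\varphi\rangle,|\psi\rangle\in\mathbb{C}^4$ with $\frac14\sum_{(\alpha,\beta)\in Q}|\langle\varphi|\sigma_{\alpha\beta}|\psi\rangle|^2=1$.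 A covering of $I$ is a collection of (not necessarily disjoint) special quadruples contained in $I$; it is uniform, of multiplicity $M$, if every point of $I$ belongs to exactly $M$ of its quadruples. A minimal covering is a uniform covering of multiplicity $M\ge1$ having the smallest cardinality among all such uniform coverings of $I$. *)

theory Defs
  imports "HOL-Analysis.Analysis"
begin

text \<open>
  The space \<open>\<complex>\<^sup>4\<close> on which the matrices \<open>\<sigma>\<^sub>\<alpha>\<^sub>\<beta>\<close> act is \<open>\<complex>\<^sup>2 \<otimes> \<complex>\<^sup>2\<close>, with coordinates indexed by
  pairs. Taking product index types for tensor products avoids the arithmetic flattening
  of indices: the \<open>(i, j)\<close> entry of \<open>v \<otimes> w\<close> is \<open>v\<^sub>i w\<^sub>j\<close>.
\<close>

type_synonym four = "2 \<times> 2"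

definition tensor_vec :: "complex^'m \<Rightarrow> complex^'n \<Rightarrow> complex^('m \<times> 'n)" where
  "tensor_vec v w = (\<chi> i. v $ fst i * w $ snd i)"

definition tensor_mat ::
    "complex^'n^'m \<Rightarrow> complex^'q^'p \<Rightarrow> complex^('n \<times> 'q)^('m \<times> 'p)" where
  "tensor_mat A B = (\<chi> i j. A $ fst i $ fst j * B $ snd i $ snd j)"

text \<open>
  The Hermitian inner product, antilinear in the first argument. The library's \<open>inner\<close> on
  \<open>complex^'n\<close> is its real part; the library's \<open>norm\<close> is the norm of both.
\<close>

definition cinner :: "complex^'n \<Rightarrow> complex^'n \<Rightarrow> complex" where
  "cinner v w = (\<Sum>i\<in>UNIV. cnj (v $ i) * w $ i)"

definition dagger :: "complex^'n^'m \<Rightarrow> complex^'m^'n" where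
  "dagger A = (\<chi> i j. cnj (A $ j $ i))"

definition density_matrix :: "complex^'n^'n \<Rightarrow> bool" where
  "density_matrix A \<longleftrightarrow>
     dagger A = A \<and> (\<forall>v. 0 \<le> Re (cinner v (A *v v))) \<and> trace A = 1"

definition separable ::
    "complex^('m::finite \<times> 'n::finite)^('m \<times> 'n) \<Rightarrow> bool" where
  "separable \<rho> \<longleftrightarrow>
     \<rho> \<in> convex hull {tensor_mat A B | (A :: complex^'m^'m) (B :: complex^'n^'n).
                        density_matrix A \<and> density_matrix B}"

text \<open>
  The orthogonal projection onto the line spanned by a nonzero vector \<open>v\<close>, that is
  \<open>|v\<rangle>\<langle>v| / \<langle>v|v\<rangle>\<close>.
\<close>

definition proj_onto :: "complex^'n \<Rightarrow> complex^'n^'n" where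
  "proj_onto v = (\<chi> i j. v $ i * cnj (v $ j) / cinner v v)"

lemma proj_onto_mult: "proj_onto v *v w = (cinner v w / cinner v v) *s v"
  by (simp add: vec_eq_iff proj_onto_def matrix_vector_mult_def cinner_def
      sum_distrib_left sum_divide_distrib mult_ac)

lemma cinner_self: "cinner v v = of_real ((norm v)\<^sup>2)"
  by (simp add: cinner_def norm_vec_def L2_set_def sum_nonneg complex_norm_square mult.commute
      del: of_real_power)

lemma dagger_proj_onto: "dagger (proj_onto v) = proj_onto v"
  by (simp add: vec_eq_iff dagger_def proj_onto_def cinner_self)

lemma proj_onto_self: "v \<noteq> 0 \<Longrightarrow> proj_onto v *v v = v"
  by (simp add: proj_onto_mult cinner_self)

lemma proj_onto_orthogonal: "cinner v w = 0 \<Longrightarrow> proj_onto v *v w = 0"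
  by (simp add: proj_onto_mult)

definition pauli :: "nat \<Rightarrow> complex^2^2" where
  "pauli \<alpha> = [mat 1,
              vector [vector [0, 1], vector [1, 0]],
              vector [vector [0, - \<i>], vector [\<i>, 0]],
              vector [vector [1, 0], vector [0, -1]]] ! \<alpha>"

definition L16 :: "(nat \<times> nat) set" where
  "L16 = {0..3} \<times> {0..3}"

definition sigma :: "nat \<times> nat \<Rightarrow> complex^four^four" where
  "sigma p = tensor_mat (pauli (fst p)) (pauli (snd p))"

definition Psi_plus :: "complex^(four \<times> four)" where
  "Psi_plus = (1/2) *s (\<Sum>j\<in>UNIV. tensor_vec (axis j 1) (axis j 1))"

definition bell_proj :: "nat \<times> nat \<Rightarrow> complex^(four \<times> four)^(four \<times> four)" where
  "bell_proj p = proj_onto (tensor_mat (mat 1) (sigma p) *v Psi_plus)"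

definition lattice_state ::
    "(nat \<times> nat) set \<Rightarrow> complex^(four \<times> four)^(four \<times> four)" where
  "lattice_state I = (1 / real (card I)) *\<^sub>R (\<Sum>p\<in>I. bell_proj p)"

definition special_quadruple :: "(nat \<times> nat) set \<Rightarrow> bool" where
  "special_quadruple Q \<longleftrightarrow>
     Q \<subseteq> L16 \<and> card Q = 4 \<and>
     (\<exists>\<phi> \<psi> :: complex^four. norm \<phi> = 1 \<and> norm \<psi> = 1 \<and>
        (1/4) * (\<Sum>p\<in>Q. (cmod (cinner \<phi> (sigma p *v \<psi>)))\<^sup>2) = 1)"

definition covering :: "(nat \<times> nat) set \<Rightarrow> (nat \<times> nat) set set \<Rightarrow> bool" where
  "covering I \<Q> \<longleftrightarrow> (\<forall>Q\<in>\<Q>. special_quadruple Q \<and> Q \<subseteq> I)"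

definition uniform_covering :: "(nat \<times> nat) set \<Rightarrow> (nat \<times> nat) set set \<Rightarrow> nat \<Rightarrow> bool" where
  "uniform_covering I \<Q> M \<longleftrightarrow>
     covering I \<Q> \<and> (\<forall>p\<in>I. card {Q\<in>\<Q>. p \<in> Q} = M)"

definition minimal_covering :: "(nat \<times> nat) set \<Rightarrow> (nat \<times> nat) set set \<Rightarrow> nat \<Rightarrow> bool" where
  "minimal_covering I \<Q> M \<longleftrightarrow>
     uniform_covering I \<Q> M \<and> M \<ge> 1 \<and>
     (\<forall>\<Q>' M'. uniform_covering I \<Q>' M' \<and> M' \<ge> 1 \<longrightarrow> card \<Q> \<le> card \<Q>')"

end

theory Submission
  imports Defs
begin

text \<open>
  Let \<open>\<phi>\<close>, \<open>\<psi>\<close> be unit vectors witnessing that \<open>Q\<close> is special. Averaging the product state of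
  \<open>\<phi>\<^sup>* \<otimes> \<psi>\<close> over the local unitaries \<open>\<sigma>\<^sub>g\<^sup>* \<otimes> \<sigma>\<^sub>g\<close>, \<open>g \<in> L16\<close>, produces the separable state
  \<open>\<Sum>\<^sub>p \<bar>\<langle>\<phi>|\<sigma>\<^sub>p|\<psi>\<rangle>\<bar>\<^sup>2/4 P\<^sub>p\<close>, since the average removes all coherences between the Bell vectors.
  By Cauchy--Schwarz every weight is at most \<open>1/4\<close>, and the weights on the four points of \<open>Q\<close> sum
  to \<open>1\<close>; so they are all \<open>1/4\<close>, the remaining weights vanish, and the average is \<open>\<rho>\<^sub>Q\<close>.
  A uniform covering of \<open>I\<close> exhibits \<open>\<rho>\<^sub>I\<close> as the mean of such states by double counting.
\<close>

section \<open>The Hermitian inner product and rank-one density matrices\<close>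

lemma cmod_cinner_le: "cmod (cinner v w) \<le> norm v * norm w"
proof -
  have "cmod (cinner v w) \<le> (\<Sum>i\<in>UNIV. \<bar>cmod (v $ i)\<bar> * \<bar>cmod (w $ i)\<bar>)"
    unfolding cinner_def by (rule order_trans[OF norm_sum]) (simp add: norm_mult)
  also have "\<dots> \<le> norm v * norm w"
    unfolding norm_vec_def by (rule L2_set_mult_ineq)
  finally show ?thesis .
qed

lemma cinner_matrix_vector_mult_left: "cinner (A *v v) w = cinner v (dagger A *v w)"
proof -
  have "cinner (A *v v) w = (\<Sum>i\<in>UNIV. \<Sum>j\<in>UNIV. cnj (A $ i $ j) * cnj (v $ j) * w $ i)"
    by (simp add: cinner_def matrix_vector_mult_def sum_distrib_right)
  also have "\<dots> = (\<Sum>j\<in>UNIV. \<Sum>i\<in>UNIV. cnj (A $ i $ j) * cnj (v $ j) * w $ i)"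
    by (rule sum.swap)
  also have "\<dots> = cinner v (dagger A *v w)"
    by (simp add: cinner_def matrix_vector_mult_def dagger_def sum_distrib_left mult_ac)
  finally show ?thesis .
qed

lemma norm_eq_if_cinner_self_eq:
  assumes "cinner v v = cinner w w"
  shows "norm v = norm w"
proof -
  have "(norm v)\<^sup>2 = (norm w)\<^sup>2"
    using assms unfolding cinner_self of_real_eq_iff .
  then show ?thesis by simp
qed

lemma norm_unitary_mult:
  assumes "dagger U ** U = mat 1"
  shows "norm (U *v v) = norm v"
  by (rule norm_eq_if_cinner_self_eq)
    (simp add: cinner_matrix_vector_mult_left matrix_vector_mul_assoc assms)

lemma norm_cnj_vec: "norm (\<chi> i. cnj (v $ i)) = norm v"
  by (simp add: norm_vec_def)

lemma trace_proj_onto: "v \<noteq> 0 \<Longrightarrow> trace (proj_onto v) = 1"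
proof -
  assume "v \<noteq> 0"
  then have "cinner v v \<noteq> 0" by (simp add: cinner_self)
  moreover have "trace (proj_onto v) = cinner v v / cinner v v"
    unfolding trace_def proj_onto_def
    by (simp flip: sum_divide_distrib) (simp add: cinner_def mult.commute)
  ultimately show ?thesis by simp
qed

lemma density_matrix_proj_onto:
  assumes "v \<noteq> 0"
  shows "density_matrix (proj_onto v)"
proof -
  have "0 \<le> Re (cinner w (proj_onto v *v w))" for w
  proof -
    have "cinner w (c *s u) = c * cinner w u" for c u
      by (simp add: cinner_def sum_distrib_left mult_ac)
    moreover have "cinner w v = cnj (cinner v w)"
      by (simp add: cinner_def mult.commute)
    \<comment> \<open>The expectation of a rank-one projection is a squared modulus over a squared
      norm, hence real and nonnegative.\<close>
    ultimately have "cinner w (proj_onto v *v w)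
        = of_real ((cmod (cinner v w))\<^sup>2 / (norm v)\<^sup>2)"
      unfolding proj_onto_mult by (simp add: cinner_self complex_norm_square del: of_real_power)
    then show ?thesis by simp
  qed
  with assms show ?thesis
    by (simp add: density_matrix_def dagger_proj_onto trace_proj_onto)
qed

section \<open>Tensor products of matrices\<close>

lemma sum_UNIV_prod:
  "(\<Sum>i\<in>(UNIV :: ('a::finite \<times> 'b::finite) set). f i) = (\<Sum>j\<in>UNIV. \<Sum>k\<in>UNIV. f (j, k))"
  by (simp add: sum.cartesian_product UNIV_Times_UNIV)

lemma trace_tensor_mat: "trace (tensor_mat A B) = trace A * trace B"
  by (simp add: trace_def tensor_mat_def sum_UNIV_prod sum_product)

lemma tensor_mat_mult:
  "tensor_mat A B ** tensor_mat C D = tensor_mat (A ** C) (B ** D)"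
  by (simp add: vec_eq_iff matrix_matrix_mult_def tensor_mat_def sum_UNIV_prod sum_product mult_ac)

lemma dagger_tensor_mat: "dagger (tensor_mat A B) = tensor_mat (dagger A) (dagger B)"
  by (simp add: vec_eq_iff dagger_def tensor_mat_def)

lemma tensor_mat_one: "tensor_mat (mat 1) (mat 1) = mat 1"
  by (auto simp: vec_eq_iff tensor_mat_def mat_def)

section \<open>Pauli matrices and the twirl identity\<close>

lemma sum_0_3: "sum f {0..3::nat} = f 0 + f 1 + f 2 + f 3"
  by (simp add: eval_nat_numeral add.assoc)

lemma pauli_nth:
  "pauli 0 = mat 1"
  "pauli (Suc 0) = vector [vector [0, 1], vector [1, 0]]"
  "pauli 2 = vector [vector [0, - \<i>], vector [\<i>, 0]]"
  "pauli 3 = vector [vector [1, 0], vector [0, -1]]"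
  by (simp_all add: pauli_def)

lemma le_3_cases: "\<alpha> \<le> (3::nat) \<Longrightarrow> \<alpha> = 0 \<or> \<alpha> = Suc 0 \<or> \<alpha> = 2 \<or> \<alpha> = 3"
  by auto

lemma dagger_pauli: "\<alpha> \<le> 3 \<Longrightarrow> dagger (pauli \<alpha>) = pauli \<alpha>"
  by (drule le_3_cases, elim disjE)
    (simp_all add: pauli_nth dagger_def vec_eq_iff forall_2 mat_def)

lemma pauli_square: "\<alpha> \<le> 3 \<Longrightarrow> pauli \<alpha> ** pauli \<alpha> = mat 1"
  by (drule le_3_cases, elim disjE)
    (simp_all add: pauli_nth matrix_matrix_mult_def vec_eq_iff forall_2 sum_2 mat_def)

text \<open>In this form the simplifier can evaluate every entry once the indices are concrete; the
  two elements of the index type are \<open>1\<close> and \<open>2\<close>.\<close>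

lemma pauli_entries:
  "pauli 0 $ i $ j = (if i = j then 1 else 0)"
  "pauli (Suc 0) $ i $ j = (if i = j then 0 else 1)"
  "pauli 2 $ i $ j = (if i = j then 0 else if i = 1 then - \<i> else \<i>)"
  "pauli 3 $ i $ j = (if i \<noteq> j then 0 else if i = 1 then 1 else -1)"
  using exhaust_2[of i] exhaust_2[of j] by (auto simp add: pauli_nth mat_def)

text \<open>The left side is an entry of the sum over \<alpha> of the matrix unit
  \<open>|ab><a'b'|\<close> conjugated by \<open>\<sigma>\<^sub>\<alpha>\<^sup>* \<otimes>
  \<sigma>\<^sub>\<alpha>\<close>; the right side is four times the diagonal part of that unit in
  the two-qubit Bell basis. They agree because these unitaries are diagonal in the Bell basis:
  conjugating one Pauli matrix by another only gives a sign, and the four sign patterns are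
  orthogonal characters. With eight binary indices, the proof checks all 256 cases.\<close>

lemma pauli_twirl:
  "(\<Sum>\<alpha>=0..3. cnj (pauli \<alpha> $ i $ a) * pauli \<alpha> $ k $ b * pauli \<alpha> $ i' $ a' * cnj (pauli \<alpha> $ k' $ b'))
   = (\<Sum>\<alpha>=0..3. pauli \<alpha> $ k $ i * cnj (pauli \<alpha> $ k' $ i') * cnj (pauli \<alpha> $ b $ a) * pauli \<alpha> $ b' $ a')"
  using exhaust_2[of i] exhaust_2[of a] exhaust_2[of k] exhaust_2[of b]
    exhaust_2[of i'] exhaust_2[of a'] exhaust_2[of k'] exhaust_2[of b']
  unfolding sum_0_3
  by (elim disjE; hypsubst) (simp_all add: pauli_entries)

lemma finite_L16: "finite L16"
  by (simp add: L16_def)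

lemma card_L16: "card L16 = 16"
  by (simp add: L16_def card_cartesian_product)

lemma dagger_sigma: "p \<in> L16 \<Longrightarrow> dagger (sigma p) = sigma p"
  by (auto simp: sigma_def L16_def dagger_tensor_mat dagger_pauli)

lemma sigma_unitary: "p \<in> L16 \<Longrightarrow> dagger (sigma p) ** sigma p = mat 1"
  unfolding dagger_sigma
  by (auto simp: sigma_def L16_def tensor_mat_mult pauli_square tensor_mat_one)

text \<open>Each summand is a product of a term in \<open>fst p\<close> and a term in
  \<open>snd p\<close>, so both sides factor into two sums over a single Pauli index, to which
  \<open>pauli_twirl\<close> applies separately.\<close>

lemma sigma_twirl:
  "(\<Sum>p\<in>L16. cnj (sigma p $ i $ a) * sigma p $ k $ b * sigma p $ i' $ a' * cnj (sigma p $ k' $ b'))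
   = (\<Sum>p\<in>L16. sigma p $ k $ i * cnj (sigma p $ k' $ i') * cnj (sigma p $ b $ a) * sigma p $ b' $ a')"
proof -
  have eq: "(\<Sum>p\<in>L16. f (fst p) * g (snd p)) = sum f {0..3} * sum g {0..3}"
    for f g :: "nat \<Rightarrow> complex"
    by (simp add: L16_def sum_product sum.cartesian_product split_def)
  define f g where "f = (\<lambda>i a k b i' a' k' b'. \<lambda>\<alpha>. cnj (pauli \<alpha> $ i $ a) * pauli \<alpha> $ k $ b
      * pauli \<alpha> $ i' $ a' * cnj (pauli \<alpha> $ k' $ b'))"
    and "g = (\<lambda>i a k b i' a' k' b'. \<lambda>\<alpha>. pauli \<alpha> $ k $ i * cnj (pauli \<alpha> $ k' $ i')
      * cnj (pauli \<alpha> $ b $ a) * pauli \<alpha> $ b' $ a')"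
  have fg: "sum (f i a k b i' a' k' b') {0..3} = sum (g i a k b i' a' k' b') {0..3}"
    for i a k b i' a' k' b'
    unfolding f_def g_def by (rule pauli_twirl)
  have "(\<Sum>p\<in>L16. cnj (sigma p $ i $ a) * sigma p $ k $ b * sigma p $ i' $ a' * cnj (sigma p $ k' $ b'))
    = (\<Sum>p\<in>L16. f (fst i) (fst a) (fst k) (fst b) (fst i') (fst a') (fst k') (fst b') (fst p)
               * f (snd i) (snd a) (snd k) (snd b) (snd i') (snd a') (snd k') (snd b') (snd p))"
    by (simp add: f_def sigma_def tensor_mat_def mult_ac)
  also have "\<dots> =
      (\<Sum>p\<in>L16. g (fst i) (fst a) (fst k) (fst b) (fst i') (fst a') (fst k') (fst b') (fst p)
               * g (snd i) (snd a) (snd k) (snd b) (snd i') (snd a') (snd k') (snd b') (snd p))"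
    unfolding eq fg ..
  also have "\<dots> = (\<Sum>p\<in>L16. sigma p $ k $ i * cnj (sigma p $ k' $ i') * cnj (sigma p $ b $ a)
      * sigma p $ b' $ a')"
    by (simp add: g_def sigma_def tensor_mat_def mult_ac)
  finally show ?thesis .
qed

section \<open>Bell vectors and their projections\<close>

lemma Psi_plus_nth: "Psi_plus $ i = (if fst i = snd i then 1/2 else 0)"
proof -
  have "(\<Sum>j\<in>UNIV. (axis j 1 :: complex^four) $ fst i * (axis j 1 :: complex^four) $ snd i)
      = (\<Sum>j\<in>UNIV. if j = fst i then (if fst i = snd i then 1 else 0) else 0)"
    by (rule sum.cong) (auto simp: axis_def)
  then show ?thesis by (simp add: Psi_plus_def tensor_vec_def)
qed

text \<open>Acting on one half of the maximally entangled vector vectorises \<open>S\<close>: the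
  first tensor index becomes the column, the second the row.\<close>

lemma one_tensor_mult_Psi_plus:
  "(tensor_mat (mat 1) S *v Psi_plus) $ i = S $ snd i $ fst i / 2"
proof -
  have "(tensor_mat (mat 1) S *v Psi_plus) $ i
      = (\<Sum>j\<in>UNIV. if fst i = j then (\<Sum>k\<in>UNIV. if j = k then S $ snd i $ k / 2 else 0) else 0)"
    by (auto simp: matrix_vector_mult_def tensor_mat_def mat_def sum_UNIV_prod Psi_plus_nth
        intro!: sum.cong)
  then show ?thesis by simp
qed

lemma norm_one_tensor_mult_Psi_plus:
  assumes "dagger S ** S = mat 1"
  shows "norm (tensor_mat (mat 1) S *v Psi_plus) = 1"
proof -
  have 1: "dagger (mat 1 :: complex^four^four) = mat 1"
    by (auto simp: vec_eq_iff dagger_def mat_def)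
  have "norm (tensor_mat (mat 1) S *v Psi_plus) = norm Psi_plus"
    by (rule norm_unitary_mult) (simp add: dagger_tensor_mat tensor_mat_mult assms 1 tensor_mat_one)
  also have "norm Psi_plus = 1"
    by (simp add: norm_vec_def L2_set_def sum_UNIV_prod Psi_plus_nth if_distrib sum_2 power2_eq_square
        cong: if_cong)
  finally show ?thesis .
qed

text \<open>Unitarity normalises the Bell vector, so no denominator survives; the 4 is the square of
  the 2 in \<open>one_tensor_mult_Psi_plus\<close>.\<close>

lemma bell_proj_nth:
  assumes "p \<in> L16"
  shows "bell_proj p $ x $ y = sigma p $ snd x $ fst x * cnj (sigma p $ snd y $ fst y) / 4"
  unfolding bell_proj_def proj_onto_def cinner_self
    norm_one_tensor_mult_Psi_plus[OF sigma_unitary[OF assms]]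
  by (simp add: one_tensor_mult_Psi_plus)

lemma trace_bell_proj:
  assumes "p \<in> L16"
  shows "trace (bell_proj p) = 1"
proof -
  have "tensor_mat (mat 1) (sigma p) *v Psi_plus \<noteq> 0"
    using norm_one_tensor_mult_Psi_plus[OF sigma_unitary[OF assms]] by auto
  then show ?thesis unfolding bell_proj_def by (rule trace_proj_onto)
qed

section \<open>Twirling a product state\<close>

lemma sum4_swap:
  "(\<Sum>g\<in>G. \<Sum>a\<in>A. \<Sum>b\<in>B. \<Sum>c\<in>C. \<Sum>d\<in>D. f g a b c d)
   = (\<Sum>a\<in>A. \<Sum>b\<in>B. \<Sum>c\<in>C. \<Sum>d\<in>D. \<Sum>g\<in>G. f g a b c d)"
  by (subst sum.swap, intro sum.cong refl)+

lemma sum_product4: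
  fixes s t u v :: "'a \<Rightarrow> 'b::semiring_0"
  shows "sum s A * sum t B * sum u C * sum v D
       = (\<Sum>a\<in>A. \<Sum>b\<in>B. \<Sum>c\<in>C. \<Sum>d\<in>D. s a * t b * u c * v d)"
  by (simp flip: sum_distrib_left sum_distrib_right)

text \<open>The equality is checked entrywise: the coordinates of \<phi> and \<psi> are pulled out
  of the sum over the group, \<open>sigma_twirl\<close> is applied to what remains, and the result
  is regrouped into amplitudes.\<close>

lemma twirl_product_state:
  fixes \<phi> \<psi> :: "complex^four"
  assumes \<phi>: "norm \<phi> = 1" and \<psi>: "norm \<psi> = 1"
  shows "(\<Sum>g\<in>L16. (1/16) *\<^sub>R tensor_mat (proj_onto (\<chi> i. cnj ((sigma g *v \<phi>) $ i)))
                                     (proj_onto (sigma g *v \<psi>)))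
       = (\<Sum>p\<in>L16. ((cmod (cinner \<phi> (sigma p *v \<psi>)))\<^sup>2 / 4) *\<^sub>R bell_proj p)"
proof -
  have "(\<Sum>g\<in>L16. (1/16) *\<^sub>R tensor_mat (proj_onto (\<chi> i. cnj ((sigma g *v \<phi>) $ i)))
                                     (proj_onto (sigma g *v \<psi>))) $ x $ y
      = (\<Sum>p\<in>L16. ((cmod (cinner \<phi> (sigma p *v \<psi>)))\<^sup>2 / 4) *\<^sub>R bell_proj p) $ x $ y"
    (is "?L = ?R") for x y :: "four \<times> four"
  proof -
    define i k i' k' where ik: "i = fst x" "k = snd x" "i' = fst y" "k' = snd y"
    let ?w = "\<lambda>a b a' b'. cnj (\<phi> $ a) * \<psi> $ b * \<phi> $ a' * cnj (\<psi> $ b')"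
    \<comment> \<open>All vectors here have norm 1, so the projections have trivial denominators.
      The first projection is onto a conjugated vector, which is why its coordinate at
      \<open>i'\<close> appears without conjugation.\<close>
    have "?L = (\<Sum>g\<in>L16. cnj ((sigma g *v \<phi>) $ i) * (sigma g *v \<psi>) $ k
        * (sigma g *v \<phi>) $ i' * cnj ((sigma g *v \<psi>) $ k')) / 16"
      by (simp add: sum_divide_distrib tensor_mat_def proj_onto_def cinner_self norm_cnj_vec
          norm_unitary_mult sigma_unitary \<phi> \<psi> ik scaleR_conv_of_real[where 'a=complex] mult_ac)
    also have "\<dots> = (\<Sum>a\<in>UNIV. \<Sum>b\<in>UNIV. \<Sum>a'\<in>UNIV. \<Sum>b'\<in>UNIV. ?w a b a' b' *
        (\<Sum>g\<in>L16. cnj (sigma g $ i $ a) * sigma g $ k $ b * sigma g $ i' $ a'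
          * cnj (sigma g $ k' $ b'))) / 16"
    proof -
      have "(\<Sum>g\<in>L16. cnj ((sigma g *v \<phi>) $ i) * (sigma g *v \<psi>) $ k
          * (sigma g *v \<phi>) $ i' * cnj ((sigma g *v \<psi>) $ k'))
        = (\<Sum>g\<in>L16. \<Sum>a\<in>UNIV. \<Sum>b\<in>UNIV. \<Sum>a'\<in>UNIV. \<Sum>b'\<in>UNIV.
            cnj (sigma g $ i $ a * \<phi> $ a) * (sigma g $ k $ b * \<psi> $ b)
            * (sigma g $ i' $ a' * \<phi> $ a') * cnj (sigma g $ k' $ b' * \<psi> $ b'))"
        by (simp only: matrix_vector_mult_def vec_lambda_beta cnj_sum sum_product4)
      also have "\<dots> = (\<Sum>a\<in>UNIV. \<Sum>b\<in>UNIV. \<Sum>a'\<in>UNIV. \<Sum>b'\<in>UNIV. \<Sum>g\<in>L16.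
            cnj (sigma g $ i $ a * \<phi> $ a) * (sigma g $ k $ b * \<psi> $ b)
            * (sigma g $ i' $ a' * \<phi> $ a') * cnj (sigma g $ k' $ b' * \<psi> $ b'))"
        by (rule sum4_swap)
      finally show ?thesis by (simp add: sum_distrib_left mult_ac)
    qed
    also have "\<dots> = (\<Sum>a\<in>UNIV. \<Sum>b\<in>UNIV. \<Sum>a'\<in>UNIV. \<Sum>b'\<in>UNIV. ?w a b a' b' *
        (\<Sum>p\<in>L16. sigma p $ k $ i * cnj (sigma p $ k' $ i') * cnj (sigma p $ b $ a)
          * sigma p $ b' $ a')) / 16"
      unfolding sigma_twirl ..
    \<comment> \<open>After the twirl, \<open>(a, b)\<close> and \<open>(a', b')\<close> no longer
      share a matrix entry, so the fourfold sum splits into a product of two double sums.\<close>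
    also have "\<dots> = (\<Sum>p\<in>L16. sigma p $ k $ i * cnj (sigma p $ k' $ i') *
        ((\<Sum>a\<in>UNIV. \<Sum>b\<in>UNIV. cnj (sigma p $ b $ a) * cnj (\<phi> $ a) * \<psi> $ b)
         * (\<Sum>a\<in>UNIV. \<Sum>b\<in>UNIV. sigma p $ b $ a * \<phi> $ a * cnj (\<psi> $ b)))) / 16"
    proof -
      have prod: "(\<Sum>a\<in>UNIV. \<Sum>b\<in>UNIV. f a b) * (\<Sum>a\<in>UNIV. \<Sum>b\<in>UNIV. h a b)
        = (\<Sum>a\<in>UNIV. \<Sum>b\<in>UNIV. \<Sum>a'\<in>UNIV. \<Sum>b'\<in>UNIV. f a b * h a' b')"
        for f h :: "four \<Rightarrow> four \<Rightarrow> complex"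
        unfolding sum_distrib_right by (simp only: sum_distrib_left)
      have "(\<Sum>a\<in>UNIV. \<Sum>b\<in>UNIV. \<Sum>a'\<in>UNIV. \<Sum>b'\<in>UNIV. ?w a b a' b' *
          (\<Sum>p\<in>L16. sigma p $ k $ i * cnj (sigma p $ k' $ i') * cnj (sigma p $ b $ a)
            * sigma p $ b' $ a'))
        = (\<Sum>a\<in>UNIV. \<Sum>b\<in>UNIV. \<Sum>a'\<in>UNIV. \<Sum>b'\<in>UNIV. \<Sum>p\<in>L16.
            sigma p $ k $ i * cnj (sigma p $ k' $ i') *
            (cnj (sigma p $ b $ a) * cnj (\<phi> $ a) * \<psi> $ b
             * (sigma p $ b' $ a' * \<phi> $ a' * cnj (\<psi> $ b'))))"
        by (simp add: sum_distrib_left mult_ac)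
      also have "\<dots> = (\<Sum>p\<in>L16. \<Sum>a\<in>UNIV. \<Sum>b\<in>UNIV. \<Sum>a'\<in>UNIV. \<Sum>b'\<in>UNIV.
            sigma p $ k $ i * cnj (sigma p $ k' $ i') *
            (cnj (sigma p $ b $ a) * cnj (\<phi> $ a) * \<psi> $ b
             * (sigma p $ b' $ a' * \<phi> $ a' * cnj (\<psi> $ b'))))"
        by (rule sum4_swap[symmetric])
      finally show ?thesis unfolding prod by (simp only: sum_distrib_left)
    qed
    \<comment> \<open>The two double sums are complex conjugates of each other; since
      \<open>sigma p\<close> is Hermitian, the first is the amplitude
      \<open>cinner \<phi> (sigma p *v \<psi>)\<close>.\<close>
    also have "\<dots> = (\<Sum>p\<in>L16. sigma p $ k $ i * cnj (sigma p $ k' $ i') *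
        of_real ((cmod (cinner \<phi> (sigma p *v \<psi>)))\<^sup>2)) / 16"
    proof -
      have "(\<Sum>a\<in>UNIV. \<Sum>b\<in>UNIV. cnj (sigma p $ b $ a) * cnj (\<phi> $ a) * \<psi> $ b)
          * (\<Sum>a\<in>UNIV. \<Sum>b\<in>UNIV. sigma p $ b $ a * \<phi> $ a * cnj (\<psi> $ b))
        = of_real ((cmod (cinner \<phi> (sigma p *v \<psi>)))\<^sup>2)" if "p \<in> L16" for p
      proof -
        have "cinner \<phi> (sigma p *v \<psi>) = cinner (sigma p *v \<phi>) \<psi>"
          using that by (simp add: cinner_matrix_vector_mult_left dagger_sigma)
        also have "\<dots> = (\<Sum>b\<in>UNIV. \<Sum>a\<in>UNIV. cnj (sigma p $ b $ a) * cnj (\<phi> $ a) * \<psi> $ b)"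
          by (simp add: cinner_def matrix_vector_mult_def sum_distrib_right)
        also have "\<dots> = (\<Sum>a\<in>UNIV. \<Sum>b\<in>UNIV. cnj (sigma p $ b $ a) * cnj (\<phi> $ a) * \<psi> $ b)"
          by (rule sum.swap)
        finally show ?thesis
          unfolding complex_norm_square by simp
      qed
      then show ?thesis by simp
    qed
    \<comment> \<open>The factor 1/16 of the average splits into the 1/4 inside
      \<open>bell_proj_nth\<close> and the 1/4 in the weight.\<close>
    also have "\<dots> = ?R"
      by (simp add: sum_divide_distrib bell_proj_nth ik scaleR_conv_of_real[where 'a=complex] mult_ac)
    finally show ?thesis .
  qed
  then show ?thesis by (simp add: vec_eq_iff)
qed

section \<open>Weights of the twirled state and special quadruples\<close>

lemma trace_sum_matrices: "trace (\<Sum>x\<in>X. f x) = (\<Sum>x\<in>X. trace (f x))"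
  by (simp add: trace_def sum.swap[of _ X])

lemma trace_scaleR: "trace (c *\<^sub>R A) = c *\<^sub>R trace A"
  by (simp add: trace_def scaleR_sum_right)

lemma twirl_factors_nonzero:
  fixes \<phi> \<psi> :: "complex^four"
  assumes "norm \<phi> = 1" and "norm \<psi> = 1" and "g \<in> L16"
  shows "(\<chi> i. cnj ((sigma g *v \<phi>) $ i)) \<noteq> 0" and "sigma g *v \<psi> \<noteq> 0"
proof -
  have "norm (\<chi> i. cnj ((sigma g *v \<phi>) $ i)) = 1" "norm (sigma g *v \<psi>) = 1"
    using assms by (simp_all add: norm_cnj_vec norm_unitary_mult sigma_unitary)
  then show "(\<chi> i. cnj ((sigma g *v \<phi>) $ i)) \<noteq> 0" and "sigma g *v \<psi> \<noteq> 0"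
    by (auto simp only: norm_zero zero_neq_one)
qed

text \<open>This is Parseval for the orthogonal basis of matrices \<open>sigma p\<close>. It is read
  off from \<open>twirl_product_state\<close> by taking traces: the average of product states has
  trace 1, and so does every Bell projection.\<close>

lemma sum_cmod_cinner_sigma:
  fixes \<phi> \<psi> :: "complex^four"
  assumes "norm \<phi> = 1" and "norm \<psi> = 1"
  shows "(\<Sum>p\<in>L16. (cmod (cinner \<phi> (sigma p *v \<psi>)))\<^sup>2) = 4"
proof -
  have "complex_of_real ((\<Sum>p\<in>L16. (cmod (cinner \<phi> (sigma p *v \<psi>)))\<^sup>2) / 4)
      = trace (\<Sum>p\<in>L16. ((cmod (cinner \<phi> (sigma p *v \<psi>)))\<^sup>2 / 4) *\<^sub>R bell_proj p)"
    by (simp add: trace_sum_matrices trace_scaleR trace_bell_proj scaleR_conv_of_real[where 'a=complex]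
        sum_divide_distrib)
  also have "\<dots> = 1"
    unfolding twirl_product_state[OF assms, symmetric]
    by (simp add: trace_sum_matrices trace_scaleR trace_tensor_mat trace_proj_onto
        twirl_factors_nonzero[OF assms] card_L16 scaleR_conv_of_real[where 'a=complex])
  finally show ?thesis
    unfolding of_real_eq_1_iff by simp
qed

lemma separable_lattice_state_special_quadruple:
  assumes "special_quadruple Q"
  shows "separable (lattice_state Q)"
proof -
  obtain \<phi> \<psi> :: "complex^four" where \<phi>: "norm \<phi> = 1" and \<psi>: "norm \<psi> = 1"
    and Q: "Q \<subseteq> L16" "card Q = 4"
    and sum_Q: "(\<Sum>p\<in>Q. (cmod (cinner \<phi> (sigma p *v \<psi>)))\<^sup>2) = 4"
    using assms unfolding special_quadruple_def by auto
  let ?c = "\<lambda>p. (cmod (cinner \<phi> (sigma p *v \<psi>)))\<^sup>2"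
  have "finite Q" using Q finite_L16 finite_subset by blast
  have le: "?c p \<le> 1" if "p \<in> Q" for p
  proof -
    have "p \<in> L16" using Q that by blast
    then have "cmod (cinner \<phi> (sigma p *v \<psi>)) \<le> 1"
      using cmod_cinner_le[of \<phi> "sigma p *v \<psi>"] by (simp add: norm_unitary_mult sigma_unitary \<phi> \<psi>)
    then show ?thesis by (simp add: power_le_one)
  qed
  \<comment> \<open>Four terms bounded by 1 add up to 4, so the nonnegative deficits all
    vanish.\<close>
  have "(\<Sum>p\<in>Q. 1 - ?c p) = 0"
    using Q sum_Q by (simp add: sum_subtractf)
  then have on_Q: "?c p = 1" if "p \<in> Q" for p
    using that le \<open>finite Q\<close> by (subst (asm) sum_nonneg_eq_0_iff) auto
  \<comment> \<open>The points of \<open>Q\<close> already exhaust the total 4 of all sixteen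
    weights.\<close>
  have "(\<Sum>p\<in>L16 - Q. ?c p) = 0"
    using sum_diff[OF finite_L16 Q(1), of ?c] sum_cmod_cinner_sigma[OF \<phi> \<psi>] sum_Q by simp
  then have off_Q: "?c p = 0" if "p \<in> L16 - Q" for p
    using that finite_L16 by (subst (asm) sum_nonneg_eq_0_iff) auto
  have "lattice_state Q = (\<Sum>p\<in>Q. (?c p / 4) *\<^sub>R bell_proj p)"
    by (simp add: lattice_state_def Q on_Q scaleR_sum_right)
  also have "\<dots> = (\<Sum>p\<in>L16. (?c p / 4) *\<^sub>R bell_proj p)"
    using Q finite_L16 off_Q by (intro sum.mono_neutral_left) auto
  also have "\<dots> = (\<Sum>g\<in>L16. (1/16) *\<^sub>R tensor_mat (proj_onto (\<chi> i. cnj ((sigma g *v \<phi>) $ i)))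
                                                  (proj_onto (sigma g *v \<psi>)))"
    by (rule twirl_product_state[OF \<phi> \<psi>, symmetric])
  finally have eq: "lattice_state Q = \<dots>" .
  show ?thesis
    unfolding separable_def eq
  proof (rule convex_sum[OF finite_L16 convex_convex_hull])
    fix g assume "g \<in> L16"
    note nz = twirl_factors_nonzero[OF \<phi> \<psi> this]
    show "tensor_mat (proj_onto (\<chi> i. cnj ((sigma g *v \<phi>) $ i))) (proj_onto (sigma g *v \<psi>))
      \<in> convex hull {tensor_mat A B | (A :: complex^four^four) (B :: complex^four^four).
                        density_matrix A \<and> density_matrix B}"
      using nz[THEN density_matrix_proj_onto] by (intro hull_inc) blast
  qed (simp_all add: card_L16)
qed

section \<open>Double counting over a uniform covering\<close>

lemma sum_sum_uniform:
  assumes "finite I" and "finite \<Q>" and "\<And>Q. Q \<in> \<Q> \<Longrightarrow> Q \<subseteq> I"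
    and "\<And>p. p \<in> I \<Longrightarrow> card {Q \<in> \<Q>. p \<in> Q} = M"
  shows "(\<Sum>Q\<in>\<Q>. \<Sum>p\<in>Q. f p) = real M *\<^sub>R (\<Sum>p\<in>I. f p :: 'a::real_vector)"
proof -
  have "(\<Sum>Q\<in>\<Q>. \<Sum>p\<in>Q. f p) = (\<Sum>Q\<in>\<Q>. \<Sum>p | p \<in> I \<and> p \<in> Q. f p)"
    using assms(3) by (intro sum.cong refl) auto
  \<comment> \<open>Summing over the point first, \<open>f p\<close> occurs once for each of the
    \<open>M\<close> quadruples through \<open>p\<close>.\<close>
  also have "\<dots> = (\<Sum>p\<in>I. \<Sum>Q | Q \<in> \<Q> \<and> p \<in> Q. f p)"
    by (rule sum.swap_restrict[OF assms(2,1)])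
  also have "\<dots> = real M *\<^sub>R (\<Sum>p\<in>I. f p)"
    by (simp add: sum_constant_scaleR assms(4) scaleR_sum_right)
  finally show ?thesis .
qed

theorem proposition6:
  fixes I :: "(nat \<times> nat) set" and \<Q> :: "(nat \<times> nat) set set" and M :: nat
  assumes "I \<subseteq> L16" and "I \<noteq> {}"
    and "minimal_covering I \<Q> M"
  shows "lattice_state I = (1 / real (card \<Q>)) *\<^sub>R (\<Sum>Q\<in>\<Q>. lattice_state Q)
       \<and> separable (lattice_state I)"
proof -
  have "M \<ge> 1" and special: "\<And>Q. Q \<in> \<Q> \<Longrightarrow> special_quadruple Q"
    and sub: "\<And>Q. Q \<in> \<Q> \<Longrightarrow> Q \<subseteq> I"
    and mult: "\<And>p. p \<in> I \<Longrightarrow> card {Q \<in> \<Q>. p \<in> Q} = M"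
    using assms(3) unfolding minimal_covering_def uniform_covering_def covering_def by auto
  have card_Q: "card Q = 4" if "Q \<in> \<Q>" for Q
    using special[OF that] by (simp add: special_quadruple_def)
  have finI: "finite I" using assms(1) finite_L16 by (rule finite_subset)
  have fin: "finite \<Q>"
    by (rule finite_subset[of _ "Pow I"]) (use sub finI in auto)
  note double_count = sum_sum_uniform[OF finI fin sub mult]
  \<comment> \<open>Counting incidences, the case of the constant function 1, fixes the
    normalisation.\<close>
  have count: "4 * real (card \<Q>) = real M * real (card I)"
    using double_count[of "\<lambda>_. 1 :: real"] by (simp add: card_Q)
  have pos: "real (card I) > 0" "real M > 0"
    using finI assms(2) \<open>M \<ge> 1\<close> by (auto simp: card_gt_0_iff)
  then have "real M * real (card I) > 0" by simp
  \<comment> \<open>The covering is thus nonempty, and 1 / \<open>card \<Q>\<close> is a genuine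
    convex weight.\<close>
  with count have N: "real (card \<Q>) > 0" by linarith
  have "(\<Sum>Q\<in>\<Q>. lattice_state Q) = (1/4) *\<^sub>R (\<Sum>Q\<in>\<Q>. \<Sum>p\<in>Q. bell_proj p)"
    by (simp add: lattice_state_def card_Q scaleR_sum_right)
  also have "\<dots> = (real M / 4) *\<^sub>R (\<Sum>p\<in>I. bell_proj p)"
    by (simp add: double_count)
  finally have "(1 / real (card \<Q>)) *\<^sub>R (\<Sum>Q\<in>\<Q>. lattice_state Q)
      = (real M / (4 * real (card \<Q>))) *\<^sub>R (\<Sum>p\<in>I. bell_proj p)"
    by (simp add: mult.commute)
  \<comment> \<open>\<open>count\<close> turns the denominator into
    \<open>real M * real (card I)\<close>, and the multiplicity cancels.\<close>
  also have "\<dots> = lattice_state I"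
    unfolding count lattice_state_def using pos by simp
  finally have eq: "lattice_state I = (1 / real (card \<Q>)) *\<^sub>R (\<Sum>Q\<in>\<Q>. lattice_state Q)" ..
  have "(\<Sum>Q\<in>\<Q>. (1 / real (card \<Q>)) *\<^sub>R lattice_state Q)
      \<in> convex hull {tensor_mat A B | (A :: complex^four^four) (B :: complex^four^four).
                        density_matrix A \<and> density_matrix B}"
    using separable_lattice_state_special_quadruple[OF special] N
    by (intro convex_sum[OF fin convex_convex_hull]) (simp_all add: separable_def)
  then have "separable (lattice_state I)"
    unfolding separable_def eq scaleR_sum_right .
  with eq show ?thesis ..
qed

end
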